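(* Consider the decentralized TD(0) iterates with linear function approximation described in the context, under the following assumptions: (i) for all $t\ge0$ the tuples $\zeta^{t+1}=(S_t,A_t,S_t^+)$ are drawn i.i.d. with $S_t\sim\mu_\pi$, $A_t\sim\pi(\cdot|S_t)$, $S_t^+\sim\mathcal P^{A_t}(S_t,\cdot)$, where $\mu_\pi$ is the unique stationary distribution of the Markov chain induced by $\pi$, and the same tuple $\zeta^{t+1}$ is observed by all agents; (ii) $\|\phi(s)\|\le1$ and $|r_i(s,a)|\le R_{\max}$ for all $i\in\{1,\dots,n\}$, $s\in\mathcal S$, $a\in\mathcal A$; the matrix $A$ is full rank and $-A$ is Hurwitz (so that $A$ is positive definite). Suppose the step sizes satisfy, for all $t\ge1$, $$\frac{\alpha_t}{\alpha_{t+1}}\le\sqrt{1+(\lambda_{\min}/2)\alpha_{t+1}},\qquad\alpha_t\le\frac{\lambda_{\min}}{\beta^2}.$$ Then for any $t\ge1$, $$\mathbb{E}\|\bar\theta^{t+1}-\theta^\star\|^2\le\prod_{i=1}^{t+1}(1-\lambda_{\min}\alpha_i)\|\bar\theta^0-\theta^\star\|^2+\frac{2}{\lambda_{\min}}\Big(\frac{\sigma^2}{n}+4\beta^2\|\theta^\star\|^2\Big)\alpha_{t+1}.$$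
   Context: Multi-agent MDP. There are $n$ agents, a finite state space $\mathcal S$, finite action spaces $\mathcal A_1,\dots,\mathcal A_n$ with joint action space $\mathcal A=\mathcal A_1\times\cdots\times\mathcal A_n$, transition probability matrices $\mathcal P^a$ ($a\in\mathcal A$), local rewards $r_i:\mathcal S\times\mathcal A\to\mathbb{R}_+$, discount factor $\gamma\in(0,1)$, a policy $\pi(a|s)$, and a feature map $\phi:\mathcal S\to\mathbb{R}^d$. Decentralized TD(0). $W\in\mathbb{R}_+^{n\times n}$ is a doubly stochastic mixing matrix of a connected undirected graph on the agents. From a deterministic initialization $\{\theta_i^0\}$, with positive step sizes $(\alpha_t)_{t\ge1}$, $$\theta_i^{t+1}=\sum_{j=1}^nW_{ij}\theta_j^t+\alpha_{t+1}\,\phi(S_t)\Big(r_i(S_t,A_t)+(\gamma\phi(S_t^+)-\phi(S_t))^\top\theta_i^t\Big).$$ Let $\bar\theta^t=\frac1n\sum_{i=1}^n\theta_i^t$. Notation. For $\zeta=(s,a,s^+)$ put $A(\zeta)=\phi(s)[\phi(s)^\top-\gamma\phi(s^+)^\top]$, $b_i(\zeta)=r_i(s,a)\phi(s)$, $\bar b(\zeta)=\frac1n\sum_{i=1}^nb_i(\zeta)$; $A=\mathbb{E}_{\mu_\pi}[A(\zeta)]$ and $\bar b=\mathbb{E}_{\mu_\pi}[\bar b(\zeta)]$, expectations over $\zeta=(S,A,S^+)$ with $S\sim\mu_\pi$, $A\sim\pi(\cdot|S)$, $S^+\sim\mathcal P^A(S,\cdot)$. $\theta^\star$ is the solution of $A\theta^\star=\bar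 b$. $\lambda_{\min}$ is the minimum eigenvalue of $\frac{A+A^\top}{2}$ (positive). $\beta:=1+\gamma$ (so that $\|A(\zeta)\|\le\beta$), and $\sigma^2:=2R_{\max}^2$, where the paper takes as a standing bound of this setting $\mathbb{E}_{\mu_\pi}\big[\|\bar b-\bar b(\zeta)\|^2\big]\le\frac{2R_{\max}^2}{n}=\frac{\sigma^2}{n}$. $\|\cdot\|$ is the Euclidean/spectral norm. *)

theory Defs
  imports "HOL-Probability.Probability"
begin

text \<open>
  Agents are the elements of a finite type \<open>'n\<close>, so the number of agents is \<open>CARD('n)\<close>.  The
  individual action spaces are the subsets \<open>Act i\<close> of one common finite type \<open>'a\<close> (they may differ
  from agent to agent), and a joint action is a choice function \<open>a\<close> with \<open>a i \<in> Act i\<close>.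
  The rows of the transition matrices and of the policy are probability mass functions:
  \<open>pmf (P a s) s'\<close> is the \<open>(s, s')\<close> entry of the matrix of the joint action \<open>a\<close>, and
  \<open>pmf (\<pi> s) a\<close> is the probability of playing \<open>a\<close> in state \<open>s\<close>.
\<close>

definition joint_actions :: "('n \<Rightarrow> 'a set) \<Rightarrow> ('n \<Rightarrow> 'a) set" where
  "joint_actions Act = {a. \<forall>i. a i \<in> Act i}"

definition induced_kernel ::
    "('s \<Rightarrow> ('n \<Rightarrow> 'a) pmf) \<Rightarrow> (('n \<Rightarrow> 'a) \<Rightarrow> 's \<Rightarrow> 's pmf) \<Rightarrow> 's \<Rightarrow> 's pmf" where
  "induced_kernel \<pi> P s = bind_pmf (\<pi> s) (\<lambda>a. P a s)"

definition stationary :: "('s \<Rightarrow> 's pmf) \<Rightarrow> 's pmf \<Rightarrow> bool" where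
  "stationary K \<mu> \<longleftrightarrow> bind_pmf \<mu> K = \<mu>"

definition unique_stationary :: "('s \<Rightarrow> 's pmf) \<Rightarrow> 's pmf \<Rightarrow> bool" where
  "unique_stationary K \<mu> \<longleftrightarrow> stationary K \<mu> \<and> (\<forall>\<nu>. stationary K \<nu> \<longrightarrow> \<nu> = \<mu>)"

text \<open>The law of \<open>(S, A, S\<^sup>+)\<close> with \<open>S \<sim> \<mu>\<close>, \<open>A \<sim> \<pi>(\<cdot>|S)\<close> and \<open>S\<^sup>+ \<sim> P\<^sup>A(S, \<cdot>)\<close>.\<close>

definition tuple_pmf ::
    "'s pmf \<Rightarrow> ('s \<Rightarrow> ('n \<Rightarrow> 'a) pmf) \<Rightarrow> (('n \<Rightarrow> 'a) \<Rightarrow> 's \<Rightarrow> 's pmf) \<Rightarrow>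
     ('s \<times> ('n \<Rightarrow> 'a) \<times> 's) pmf" where
  "tuple_pmf \<mu> \<pi> P =
     bind_pmf \<mu> (\<lambda>s. bind_pmf (\<pi> s) (\<lambda>a. map_pmf (\<lambda>s'. (s, a, s')) (P a s)))"

text \<open>The outer product \<open>\<phi>(s) [\<phi>(s) - \<gamma> \<phi>(s\<^sup>+)]\<^sup>T\<close>.\<close>

definition td_A :: "real \<Rightarrow> ('s \<Rightarrow> real^'d) \<Rightarrow> 's \<times> 'b \<times> 's \<Rightarrow> real^'d^'d" where
  "td_A \<gamma> \<phi> = (\<lambda>(s, a, s'). \<chi> k l. \<phi> s $ k * (\<phi> s - \<gamma> *\<^sub>R \<phi> s') $ l)"

definition td_b ::
    "('s \<Rightarrow> real^'d) \<Rightarrow> ('n \<Rightarrow> 's \<Rightarrow> 'b \<Rightarrow> real) \<Rightarrow> 'n \<Rightarrow> 's \<times> 'b \<times> 's \<Rightarrow> real^'d" where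
  "td_b \<phi> r i = (\<lambda>(s, a, s'). r i s a *\<^sub>R \<phi> s)"

definition agent_avg :: "('n::finite \<Rightarrow> 'v::real_vector) \<Rightarrow> 'v" where
  "agent_avg x = (1 / real CARD('n)) *\<^sub>R (\<Sum>i\<in>UNIV. x i)"

definition td_bbar ::
    "('s \<Rightarrow> real^'d) \<Rightarrow> ('n::finite \<Rightarrow> 's \<Rightarrow> 'b \<Rightarrow> real) \<Rightarrow> 's \<times> 'b \<times> 's \<Rightarrow> real^'d" where
  "td_bbar \<phi> r \<zeta> = agent_avg (\<lambda>i. td_b \<phi> r i \<zeta>)"

text \<open>
  The iterates along one trajectory \<open>z\<close> of tuples.  The tuple used in the step from \<open>t\<close> to \<open>t + 1\<close>
  is \<open>z (t + 1) = (S\<^sub>t, A\<^sub>t, S\<^sub>t\<^sup>+)\<close>, the same one for all agents; \<open>z 0\<close> and \<open>\<alpha> 0\<close> are not used.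
\<close>

primrec td_iterate ::
    "real^'n^'n \<Rightarrow> (nat \<Rightarrow> real) \<Rightarrow> real \<Rightarrow> ('s \<Rightarrow> real^'d) \<Rightarrow> ('n::finite \<Rightarrow> 's \<Rightarrow> 'b \<Rightarrow> real) \<Rightarrow>
     ('n \<Rightarrow> real^'d) \<Rightarrow> (nat \<Rightarrow> 's \<times> 'b \<times> 's) \<Rightarrow> nat \<Rightarrow> 'n \<Rightarrow> real^'d" where
  "td_iterate W \<alpha> \<gamma> \<phi> r \<theta>0 z 0 = \<theta>0"
| "td_iterate W \<alpha> \<gamma> \<phi> r \<theta>0 z (Suc t) = (\<lambda>i.
     (\<Sum>j\<in>UNIV. W $ i $ j *\<^sub>R td_iterate W \<alpha> \<gamma> \<phi> r \<theta>0 z t j) +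
     (case z (Suc t) of (s, a, s') \<Rightarrow>
        (\<alpha> (Suc t) * (r i s a + (\<gamma> *\<^sub>R \<phi> s' - \<phi> s) \<bullet> td_iterate W \<alpha> \<gamma> \<phi> r \<theta>0 z t i)) *\<^sub>R \<phi> s))"

definition undirected_connected_graph :: "('n \<times> 'n) set \<Rightarrow> bool" where
  "undirected_connected_graph E \<longleftrightarrow> sym E \<and> irrefl E \<and> E\<^sup>* = UNIV"

text \<open>
  Off-diagonal weights vanish outside the edges.  Weights on edges are not required to be positive,
  nor \<open>W\<close> to be symmetric.
\<close>

definition doubly_stochastic_mixing :: "('n \<times> 'n) set \<Rightarrow> real^'n^'n \<Rightarrow> bool" where
  "doubly_stochastic_mixing E W \<longleftrightarrow>
     (\<forall>i j. 0 \<le> W $ i $ j) \<and>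
     (\<forall>i. (\<Sum>j\<in>UNIV. W $ i $ j) = 1) \<and>
     (\<forall>j. (\<Sum>i\<in>UNIV. W $ i $ j) = 1) \<and>
     (\<forall>i j. i \<noteq> j \<and> (i, j) \<notin> E \<longrightarrow> W $ i $ j = 0)"

definition is_eigenvalue :: "('f::field)^'d^'d \<Rightarrow> 'f \<Rightarrow> bool" where
  "is_eigenvalue M l \<longleftrightarrow> (\<exists>v. v \<noteq> 0 \<and> M *v v = l *s v)"

text \<open>Meant for symmetric real matrices, whose eigenvalues form a finite nonempty set of reals.\<close>

definition min_eigenvalue :: "real^'d^'d \<Rightarrow> real" where
  "min_eigenvalue M = Min {l. is_eigenvalue M l}"

definition hurwitz :: "real^'d^'d \<Rightarrow> bool" where
  "hurwitz M \<longleftrightarrow>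
     (\<forall>l. is_eigenvalue (\<chi> i j. complex_of_real (M $ i $ j)) l \<longrightarrow> Re l < 0)"

end

theory Submission
  imports Defs
begin

text \<open>
  Averaging over the agents removes the mixing matrix, so \<open>e\<^sub>t = \<theta>bar t - \<theta>star\<close> follows
  \<open>e' = e + \<alpha> (bbar(\<zeta>) - A(\<zeta>) (e + \<theta>star))\<close> with a fresh sample \<open>\<zeta>\<close>.  Let \<open>A\<^sub>0(\<zeta>) = A(\<zeta>) - A\<close> and let
  \<open>S(v)\<close> be the mean of \<open>\<bar>A\<^sub>0(\<zeta>) v\<bar>\<^sup>2\<close>.  Stationarity gives \<open>E \<bar>A(\<zeta>) v\<bar>\<^sup>2 \<le> \<beta> (v \<bullet> A v)\<close>; with
  \<open>v \<bullet> A v = \<beta> q \<bar>v\<bar>\<^sup>2\<close> this forces \<open>y := lmin / \<beta> \<le> q \<le> 1\<close> and \<open>S(v) \<le> \<beta>\<^sup>2 (q - q\<^sup>2) \<bar>v\<bar>\<^sup>2\<close>.  Only the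
  centred part of \<open>A(\<zeta>) e\<close> correlates with the noise, so Young's inequality with weight \<open>p\<close> yields
  \<open>E \<bar>e'\<bar>\<^sup>2 \<le> (1 - lmin \<alpha>) \<bar>e\<bar>\<^sup>2 + \<alpha>\<^sup>2 w (1 + 1/p) C\<close>, where \<open>C = \<sigma>\<^sup>2/n + 4 \<beta>\<^sup>2 \<bar>\<theta>star\<bar>\<^sup>2\<close> and
  \<open>w = 1 + min (1/4) (1 - y) / 4\<close> since \<open>q - q\<^sup>2 \<le> min (1/4) (1 - y)\<close>.

  A crude choice of \<open>p\<close> is too lossy for the constant \<open>2 / lmin\<close>.  With \<open>c = \<alpha> \<beta>\<^sup>2 / lmin \<in> (0, 1]\<close>, the
  induction closes because of two different upper bounds on the ratio of consecutive step sizes: one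
  is the assumed ratio condition, the other is \<open>1 / c\<close>, and the latter wins near \<open>c = 1\<close>.
\<close>

section \<open>Rayleigh bound for symmetric matrices\<close>

lemma symmetric_matrix_inner:
  fixes M :: "real^'d^'d"
  assumes "transpose M = M"
  shows "(M *v x) \<bullet> y = x \<bullet> (M *v y)"
  by (metis assms dot_lmul_matrix vector_transpose_matrix)

text \<open>\<open>Min\<close> in \<open>min_eigenvalue\<close> is a lower bound only over a finite
  set. Choosing one eigenvector per eigenvalue gives an orthogonal, hence independent family, and
  such a family is finite.\<close>

lemma finite_eigenvalues_symmetric:
  fixes M :: "real^'d^'d"
  assumes sym: "transpose M = M"
  shows "finite {l. is_eigenvalue M l}"
proof -
  have "\<exists>v. \<forall>l. is_eigenvalue M l \<longrightarrow> v l \<noteq> 0 \<and> M *v v l = l *s v l"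
    unfolding is_eigenvalue_def by (rule choice) blast
  then obtain v where v: "\<And>l. is_eigenvalue M l \<Longrightarrow> v l \<noteq> 0 \<and> M *v v l = l *s v l"
    by blast
  have orth: "v k \<bullet> v l = 0" if "is_eigenvalue M k" "is_eigenvalue M l" "k \<noteq> l" for k l
  proof -
    have "k * (v k \<bullet> v l) = l * (v k \<bullet> v l)"
      using symmetric_matrix_inner[OF sym, of "v k" "v l"] v that by (simp add: scalar_mult_eq_scaleR)
    then show ?thesis using that by simp
  qed
  let ?B = "v ` {l. is_eigenvalue M l}"
  have inj: "inj_on v {l. is_eigenvalue M l}"
  proof (rule inj_onI, rule ccontr)
    fix k l assume *: "k \<in> {l. is_eigenvalue M l}" "l \<in> {l. is_eigenvalue M l}" "v k = v l" "k \<noteq> l"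
    then have "v l \<bullet> v l = 0" using orth[of k l] by simp
    with * v[of l] show False by simp
  qed
  have "independent ?B"
    by (rule pairwise_orthogonal_independent)
      (use orth v in \<open>force simp: pairwise_def orthogonal_def\<close>)+
  then have "finite ?B" by (rule independent_imp_finite)
  then show ?thesis using inj by (rule finite_imageD)
qed

text \<open>By compactness the quadratic form has a minimiser on the unit sphere, and this minimiser
  is an eigenvector. Its eigenvalue \<open>m\<close> is the minimum of the form there, and
  \<open>min_eigenvalue M \<le> m\<close>.\<close>

lemma min_eigenvalue_rayleigh:
  fixes M :: "real^'d^'d"
  assumes sym: "transpose M = M"
  shows "min_eigenvalue M * (norm x)\<^sup>2 \<le> x \<bullet> (M *v x)"
proof -
  let ?S = "sphere (0::real^'d) 1"
  have "continuous_on ?S (\<lambda>x. x \<bullet> (M *v x))"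
    by (intro continuous_on_inner continuous_on_id matrix_vector_mult_linear_continuous_on)
  then have "\<exists>v\<in>?S. \<forall>u\<in>?S. v \<bullet> (M *v v) \<le> u \<bullet> (M *v u)"
    by (intro continuous_attains_inf compact_sphere) simp_all
  then obtain v where v: "v \<in> ?S" and vmin: "\<And>u. u \<in> ?S \<Longrightarrow> v \<bullet> (M *v v) \<le> u \<bullet> (M *v u)"
    by blast
  define m where "m = v \<bullet> (M *v v)"
  have ray: "m * (u \<bullet> u) \<le> u \<bullet> (M *v u)" for u
  proof (cases "u = 0")
    case False
    then have "m \<le> (u /\<^sub>R norm u) \<bullet> (M *v (u /\<^sub>R norm u))"
      unfolding m_def by (intro vmin) simp
    also have "\<dots> = (u \<bullet> (M *v u)) / (norm u)\<^sup>2"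
      by (simp add: matrix_vector_mult_scaleR power2_eq_square divide_simps)
    finally show ?thesis using False
      by (simp add: field_simps power2_norm_eq_inner)
  qed simp
  define g where "g = M *v v - m *\<^sub>R v"
  have vv: "v \<bullet> v = 1" using v by (simp add: norm_eq_1)
  text \<open>The form \<open>u \<bullet> (M - m) u\<close> is nonnegative and vanishes at \<open>v\<close>, so its gradient vanishes there.\<close>
  have "g \<bullet> g = 0"
  proof (rule ccontr)
    assume "g \<bullet> g \<noteq> 0"
    then have gpos: "g \<bullet> g > 0" by simp
    define k where "k = g \<bullet> (M *v g) - m * (g \<bullet> g)"
    have quad: "0 \<le> 2 * t * (g \<bullet> g) + t\<^sup>2 * k" for t
    proof -
      have "m * ((v + t *\<^sub>R g) \<bullet> (v + t *\<^sub>R g)) \<le> (v + t *\<^sub>R g) \<bullet> (M *v (v + t *\<^sub>R g))"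
        by (rule ray)
      moreover have "v \<bullet> (M *v g) = g \<bullet> (M *v v)"
        using symmetric_matrix_inner[OF sym, of v g] by (simp add: inner_commute)
      moreover have "g \<bullet> (M *v v) = g \<bullet> g + m * (g \<bullet> v)"
        unfolding g_def by (simp add: inner_diff_left inner_diff_right)
      ultimately show ?thesis
        unfolding k_def using vv m_def
        by (simp add: matrix_vector_mult_scaleR matrix_vector_right_distrib inner_add_left
            inner_add_right algebra_simps power2_eq_square inner_commute)
    qed
    have "k \<ge> 0" using ray[of g] by (simp add: k_def)
    then have "k + 1 > 0" by simp
    \<comment> \<open>The optimal \<open>t\<close> would be \<open>- (g \<bullet> g) / k\<close>;
      the denominator \<open>k + 1\<close> covers \<open>k = 0\<close> too and still makes the
      quadratic negative.\<close>
    from quad[of "- (g \<bullet> g) / (k + 1)"]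
    have "0 \<le> - 2 * (g \<bullet> g)\<^sup>2 / (k+1) + (g \<bullet> g)\<^sup>2 * k / (k+1)\<^sup>2"
      by (simp add: power2_eq_square)
    also have "\<dots> = - (g \<bullet> g)\<^sup>2 * (k + 2) / (k+1)\<^sup>2"
      using \<open>k + 1 > 0\<close> by (simp add: divide_simps power2_eq_square) (simp add: algebra_simps)
    also have "\<dots> < 0" using gpos \<open>k \<ge> 0\<close> by (simp add: divide_neg_pos mult_neg_pos)
    finally show False by simp
  qed
  then have "is_eigenvalue M m"
    unfolding is_eigenvalue_def scalar_mult_eq_scaleR g_def using vv by (intro exI[of _ v]) auto
  then have "min_eigenvalue M \<le> m"
    unfolding min_eigenvalue_def using finite_eigenvalues_symmetric[OF sym] by (intro Min_le) auto
  then have "min_eigenvalue M * (x \<bullet> x) \<le> m * (x \<bullet> x)"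
    by (intro mult_right_mono) auto
  then show ?thesis using ray[of x] by (simp add: power2_norm_eq_inner)
qed

text \<open>The antisymmetric part of a matrix contributes nothing to its quadratic form. This
  supplies the coercivity with constant \<open>lmin\<close>.\<close>

lemma min_eigenvalue_symmetric_part:
  fixes A :: "real^'d^'d"
  shows "min_eigenvalue ((1/2) *\<^sub>R (A + transpose A)) * (norm x)\<^sup>2 \<le> x \<bullet> (A *v x)"
proof -
  let ?M = "(1/2) *\<^sub>R (A + transpose A)"
  have "transpose ?M = ?M"
    by (simp add: transpose_def vec_eq_iff)
  moreover have "x \<bullet> (?M *v x) = x \<bullet> (A *v x)"
  proof -
    have "?M *v x = (1/2) *\<^sub>R (A *v x + x v* A)"
      by (simp add: scaleR_matrix_vector_assoc[symmetric] matrix_vector_mult_add_rdistrib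
          transpose_matrix_vector)
    then show ?thesis
      by (simp add: inner_add_right inner_commute[of x "x v* A"] dot_lmul_matrix)
  qed
  ultimately show ?thesis using min_eigenvalue_rayleigh[of ?M x] by simp
qed

section \<open>The weight in Young's inequality\<close>

text \<open>In the application \<open>y = lmin / \<beta>\<close> and
  \<open>c = \<alpha> * \<beta>\<^sup>2 / lmin\<close>, so
  \<open>c * y\<^sup>2 = lmin * \<alpha>\<close>, and \<open>\<rho>\<close> bounds the ratio of the
  previous step size to the current one. The first property of \<open>p\<close> preserves the
  contraction factor \<open>1 - lmin * \<alpha>\<close>, the second closes the induction. A larger
  \<open>p\<close> helps the second and hurts the first.\<close>

lemma step_parameter:
  fixes y c \<rho> :: real
  assumes y: "0 < y" "y \<le> 1" and c: "0 < c" "c \<le> 1"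
    and \<rho>: "\<rho> \<le> 1 / c" "\<rho> \<le> 1 + c * y\<^sup>2 / 4"
  shows "\<exists>p>0. (\<forall>q. y \<le> q \<longrightarrow> q \<le> 1 \<longrightarrow> q + p * (q - q\<^sup>2) \<le> (2 * q - y) / (c * y)) \<and>
    2 * (1 - c * y\<^sup>2) * \<rho> + c * y\<^sup>2 * (min (17/16) ((5 - y) / 4) * (1 + 1 / p)) \<le> 2"
proof -
  define w where "w = min (17/16) ((5 - y) / 4)"
  have w: "w \<le> 17/16" "w \<le> (5 - y) / 4" unfolding w_def by (rule min.cobounded1 min.cobounded2)+
  define x where "x = c * y\<^sup>2"
  have x0: "0 < x" using y c by (simp add: x_def)
  have x1: "x \<le> 1" unfolding x_def using y c by (simp add: mult_le_one power_le_one)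
  have valid0: "q + 1 / (c * y) * (q - q\<^sup>2) \<le> (2 * q - y) / (c * y)" if "y \<le> q" "q \<le> 1" for q
  proof -
    have "0 \<le> (q - y) * (1 + q) + (1 - c) * q * y"
      using that y c by simp
    then have "c * y * q + (q - q\<^sup>2) \<le> 2 * q - y"
      by (simp add: algebra_simps power2_eq_square)
    then have "(c * y * q + (q - q\<^sup>2)) / (c * y) \<le> (2 * q - y) / (c * y)"
      using y c by (intro divide_right_mono) auto
    then show ?thesis using y c by (simp add: add_divide_distrib)
  qed
  \<comment> \<open>The threshold is sharp: for \<open>\<rho> = 1 + x / 4\<close> and
    \<open>k = (3 + x) / 2\<close> both sides are equal.\<close>
  have bound1: "2 * (1 - x) * \<rho> + x * k \<le> 2" if "k \<le> (3 + x) / 2" for k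
  proof -
    have "2 * (1 - x) * \<rho> + x * k \<le> 2 * (1 - x) * (1 + x / 4) + x * ((3 + x) / 2)"
      using \<rho>(2) x0 x1 that by (intro add_mono mult_left_mono) (auto simp: x_def)
    also have "\<dots> \<le> 2" using x0 by (simp add: field_simps)
    finally show ?thesis .
  qed
  \<comment> \<open>In \<open>large\<close> the weight \<open>1 / (c * y)\<close> is paired with
    \<open>\<rho> \<le> 1 / c\<close>; in \<open>small\<close> the best weight is paired with
    \<open>\<rho> \<le> 1 + x / 4\<close>. The polynomial in \<open>g\<close>, on which
    \<open>small\<close> rests, equals \<open>(1 - y) * (8 * y\<^sup>2 - 17 * y + 7)\<close> at
    \<open>c = 1\<close>, and 11/20 lies just below the smaller root of the quadratic
    factor.\<close>
  consider (one) "y = 1" | (large) "11/20 \<le> y" "24/25 \<le> c"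
    | (small) "y < 1" "y < 11/20 \<or> c < 24/25"
    using y(2) by fastforce
  then show ?thesis
  proof cases
    case one
    then have "w * (1 + 1 / (1 / (c * y))) \<le> (3 + x) / 2"
      using c by (simp add: w_def x_def)
    then show ?thesis using valid0 bound1 y c
      by (intro exI[of _ "1 / (c * y)"]) (auto simp: w_def x_def)
  next
    case large
    \<comment> \<open>Powers of \<open>c\<close> are replaced by their chords on \<open>[24/25, 1]\<close>, so that only the two endpoints,
      \<open>e0\<close> and \<open>e1\<close>, have to be checked.\<close>
    have c2: "c\<^sup>2 \<le> 49/25 * c - 24/25"
      using mult_nonneg_nonneg[of "c - 24/25" "1 - c"] large c
      by (simp add: field_simps power2_eq_square)
    have c3: "c^3 \<le> 49/25 * (49/25 * c - 24/25) - 24/25 * c"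
      using mult_left_mono[OF c2, of c] c2 c by (simp add: power2_eq_square power3_eq_cube algebra_simps)
    define e0 where "e0 = 8 * (24/25 * (1 + y\<^sup>2) - 1) - (5 - y) * y\<^sup>2 * ((24/25)\<^sup>2 + y * (24/25)^3)"
    define e1 where "e1 = 8 * y\<^sup>2 - (5 - y) * y\<^sup>2 * (1 + y)"
    \<comment> \<open>Bernstein form on \<open>[11/20, 1]\<close>\<close>
    have "e0 = 268950784/102515625 * ((y - 11/20)^0 * (1 - y)^4) +
            392877824/20503125 * ((y - 11/20)^1 * (1 - y)^3) +
            49630208/1366875 * ((y - 11/20)^2 * (1 - y)^2) +
            18182144/820125 * ((y - 11/20)^3 * (1 - y)^1) + 538624/164025 * ((y - 11/20)^4 * (1 - y)^0)"
      unfolding e0_def by (simp add: power_numeral_reduce field_simps)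
    moreover have "0 \<le> \<dots>"
      using large y by (intro add_nonneg_nonneg mult_nonneg_nonneg zero_le_power) auto
    ultimately have e0: "0 \<le> e0" by simp
    have "e1 = y\<^sup>2 * ((1 - y) * (3 - y))"
      by (simp add: e1_def algebra_simps power2_eq_square)
    then have e1: "0 \<le> e1" using y by simp
    \<comment> \<open>The factors \<open>25 * (1 - c)\<close> and \<open>25 * (c - 24/25)\<close>
      are the barycentric coordinates of \<open>c\<close> in \<open>[24/25, 1]\<close>. The chord
      version is affine in \<open>c\<close>, so it is this combination of its endpoint
      values.\<close>
    have "0 \<le> 25 * (1 - c) * e0 + 25 * (c - 24/25) * e1"
      using e0 e1 large c by (intro add_nonneg_nonneg mult_nonneg_nonneg) auto
    also have "\<dots> = 8 * (c - 1 + c * y\<^sup>2) - (5 - y) * y\<^sup>2 *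
        ((49/25 * c - 24/25) + y * (49/25 * (49/25 * c - 24/25) - 24/25 * c))"
      unfolding e0_def e1_def by (simp add: power2_eq_square power3_eq_cube) algebra
    also have "\<dots> \<le> 8 * (c - 1 + c * y\<^sup>2) - (5 - y) * y\<^sup>2 * (c\<^sup>2 + y * c^3)"
      using c2 c3 y by (intro diff_left_mono mult_left_mono add_mono) auto
    finally have key: "(5 - y) / 4 * y\<^sup>2 * c * (1 + c * y) \<le> 2 * (c - 1 + c * y\<^sup>2) / c"
      using c by (simp add: divide_simps) (simp add: algebra_simps power2_eq_square power3_eq_cube)
    have "x * (w * (1 + c * y)) \<le> x * ((5 - y) / 4 * (1 + c * y))"
      using x0 y c by (intro mult_left_mono mult_right_mono w) auto
    also have "\<dots> \<le> 2 * (c - 1 + c * y\<^sup>2) / c"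
      using key by (simp add: x_def algebra_simps)
    also have "\<dots> = 2 - 2 * (1 - x) * (1 / c)"
      using c by (simp add: x_def field_simps)
    finally have "2 * (1 - x) * (1 / c) + x * (w * (1 + c * y)) \<le> 2" by simp
    moreover have "2 * (1 - x) * \<rho> \<le> 2 * (1 - x) * (1 / c)"
      using \<rho> x1 by (intro mult_left_mono) auto
    ultimately have "2 * (1 - x) * \<rho> + x * (w * (1 + 1 / (1 / (c * y)))) \<le> 2" by simp
    then show ?thesis using valid0 y c
      by (intro exI[of _ "1 / (c * y)"]) (auto simp: w_def x_def)
  next
    case small
    have cy: "c * y < 1" using mult_right_mono[of c 1 y] small(1) y c by linarith
    \<comment> \<open>This is the largest weight that the first property allows at
      \<open>q = y\<close>, where equality holds; hence the factor \<open>q - y\<close> below. The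
      denominator vanishes at \<open>y = 1\<close>, so that case stands apart.\<close>
    define p where "p = (1 - c * y) / (c * y * (1 - y))"
    have p0: "p > 0" using cy y c small by (simp add: p_def)
    have valid: "q + p * (q - q\<^sup>2) \<le> (2 * q - y) / (c * y)" if q: "y \<le> q" "q \<le> 1" for q
    proof -
      have "0 \<le> (q - y) * ((1 - c * y) * q + (1 - y))"
        using q cy y by (intro mult_nonneg_nonneg add_nonneg_nonneg) auto
      then have "c * y * (1 - y) * q + (1 - c * y) * (q - q\<^sup>2) \<le> (2 * q - y) * (1 - y)"
        by (simp add: algebra_simps power2_eq_square)
      then have "(c * y * (1 - y) * q + (1 - c * y) * (q - q\<^sup>2)) / (c * y * (1 - y))
          \<le> ((2 * q - y) * (1 - y)) / (c * y * (1 - y))"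
        using y c small by (intro divide_right_mono) auto
      then show ?thesis using y c small by (simp add: p_def add_divide_distrib)
    qed
    \<comment> \<open>The polynomial is 16 times the gap in
      \<open>17/16 * (1 - x) \<le> (3 + x) / 2 * (1 - c * y)\<close>. It is concave in
      \<open>c\<close> and equals 7 at \<open>c = 0\<close>, so only an upper bound \<open>C\<close>
      of \<open>c\<close> has to be tested.\<close>
    have g: "0 \<le> 7 - 24 * c * y + 25 * c * y\<^sup>2 - 8 * c\<^sup>2 * y^3"
    proof -
      have concave: "0 \<le> 7 - 24 * c * y + 25 * c * y\<^sup>2 - 8 * c\<^sup>2 * y^3"
        if "c \<le> C" "0 < C" "0 \<le> 7 - 24 * C * y + 25 * C * y\<^sup>2 - 8 * C\<^sup>2 * y^3" for C
      proof -
        have "0 \<le> (C - c) * 7 + c * (7 - 24 * C * y + 25 * C * y\<^sup>2 - 8 * C\<^sup>2 * y^3)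
            + C * (8 * y^3 * c * (C - c))"
          using that c y by (intro add_nonneg_nonneg mult_nonneg_nonneg zero_le_power) auto
        also have "\<dots> = C * (7 - 24 * c * y + 25 * c * y\<^sup>2 - 8 * c\<^sup>2 * y^3)"
          by (simp add: algebra_simps power2_eq_square)
        finally show ?thesis using that by (simp add: zero_le_mult_iff)
      qed
      show ?thesis
      proof (cases "y < 11/20")
        case True
        have "0 \<le> (1 - y) * (8 * (11/20 - y)\<^sup>2 + 41/5 * (11/20 - y) + 7/100)"
          using True y by (intro mult_nonneg_nonneg add_nonneg_nonneg) auto
        also have "\<dots> = 7 - 24 * 1 * y + 25 * 1 * y\<^sup>2 - 8 * 1\<^sup>2 * y^3"
          by (simp add: power_numeral_reduce field_simps)
        finally show ?thesis using c by (intro concave[of 1]) auto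
      next
        case False
        then have c': "c \<le> 24/25" using small by auto
        have "0 \<le> 7 - 24 * (24/25) * y + 25 * (24/25) * y\<^sup>2 - 8 * (24/25)\<^sup>2 * y^3"
        proof (cases "y \<le> 7/10")
          case True
          \<comment> \<open>Bernstein forms on \<open>[0, 7/10]\<close> and \<open>[7/10, 1]\<close>\<close>
          then have "0 \<le> 1000/49 * (y^0 * (7/10 - y)^3) + 696/49 * (y^1 * (7/10 - y)^2) +
            72/49 * (y^2 * (7/10 - y)^1) + 9208/30625 * (y^3 * (7/10 - y)^0)"
            using y by (intro add_nonneg_nonneg mult_nonneg_nonneg zero_le_power) auto
          then show ?thesis by (simp add: power_numeral_reduce field_simps)
        next
          case False
          then have "0 \<le> 64456/16875 * ((y - 7/10)^0 * (1 - y)^3) +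
            9416/1125 * ((y - 7/10)^1 * (1 - y)^2) + 7576/225 * ((y - 7/10)^2 * (1 - y)^1) +
            2936/135 * ((y - 7/10)^3 * (1 - y)^0)"
            using y by (intro add_nonneg_nonneg mult_nonneg_nonneg zero_le_power) auto
          then show ?thesis by (simp add: power_numeral_reduce field_simps)
        qed
        then show ?thesis using c' by (intro concave[of "24/25"]) auto
      qed
    qed
    have "17/16 * (1 - x) \<le> (3 + x) / 2 * (1 - c * y)"
      using g by (simp add: x_def field_simps power2_eq_square power3_eq_cube)
    then have "17/16 * ((1 - x) / (1 - c * y)) \<le> (3 + x) / 2"
      using cy by (simp only: times_divide_eq_right pos_divide_le_eq diff_gt_0_iff_gt)
    moreover have "w * ((1 - x) / (1 - c * y)) \<le> 17/16 * ((1 - x) / (1 - c * y))"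
      using cy x1 w by (intro mult_right_mono) auto
    moreover have "1 + 1 / p = (1 - x) / (1 - c * y)"
      using cy y c small by (simp add: p_def x_def divide_simps) (simp add: algebra_simps power2_eq_square)
    ultimately have "w * (1 + 1 / p) \<le> (3 + x) / 2" by (simp only: order_trans)
    then show ?thesis using valid bound1 p0
      by (intro exI[of _ p]) (auto simp: w_def x_def)
  qed
qed

section \<open>One step in mean square\<close>

lemma integrable_finite_pmf [simp]:
  fixes p :: "'z::finite pmf" and f :: "'z \<Rightarrow> 'v::{banach, second_countable_topology}"
  shows "integrable (measure_pmf p) f"
  by (rule integrable_measure_pmf_finite) simp

lemma expectation_matrix_vector_mult:
  fixes p :: "'z::finite pmf" and G :: "'z \<Rightarrow> real^'d^'e"
  shows "measure_pmf.expectation p (\<lambda>z. G z *v e) = measure_pmf.expectation p G *v e"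
proof -
  have "linear (\<lambda>M :: real^'d^'e. M *v e)"
    by (intro linearI) (simp_all add: matrix_vector_mult_add_rdistrib scaleR_matrix_vector_assoc)
  then show ?thesis
    by (intro integral_bounded_linear) (simp_all add: linear_conv_bounded_linear)
qed

lemma expectation_norm_square_shift:
  fixes p :: "'z::finite pmf" and X :: "'z \<Rightarrow> 'v::euclidean_space"
  assumes "measure_pmf.expectation p X = 0"
  shows "measure_pmf.expectation p (\<lambda>z. (norm (u + X z))\<^sup>2) =
    (norm u)\<^sup>2 + measure_pmf.expectation p (\<lambda>z. (norm (X z))\<^sup>2)"
proof -
  have "(norm (u + X z))\<^sup>2 = (norm u)\<^sup>2 + 2 * (u \<bullet> X z) + (norm (X z))\<^sup>2" for z
    by (simp add: power2_norm_eq_inner inner_add_left inner_add_right inner_commute)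
  then show ?thesis using assms by simp
qed

text \<open>Minkowski's inequality: weighting each norm by the square root of its probability turns
  the root mean square into \<open>L2_set\<close>.\<close>

lemma expectation_norm_square_triangle:
  fixes p :: "'z::finite pmf" and X Y :: "'z \<Rightarrow> 'v::euclidean_space"
  shows "sqrt (measure_pmf.expectation p (\<lambda>z. (norm (X z + Y z))\<^sup>2)) \<le>
    sqrt (measure_pmf.expectation p (\<lambda>z. (norm (X z))\<^sup>2)) +
    sqrt (measure_pmf.expectation p (\<lambda>z. (norm (Y z))\<^sup>2))"
proof -
  have L2: "sqrt (measure_pmf.expectation p (\<lambda>z. (norm (f z))\<^sup>2)) =
      L2_set (\<lambda>z. sqrt (pmf p z) * norm (f z)) UNIV" for f :: "'z \<Rightarrow> 'v"
    unfolding L2_set_def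
    by (subst integral_measure_pmf_real[of UNIV]) (simp_all add: power_mult_distrib mult.commute)
  have "L2_set (\<lambda>z. sqrt (pmf p z) * norm (X z + Y z)) UNIV \<le>
      L2_set (\<lambda>z. sqrt (pmf p z) * norm (X z) + sqrt (pmf p z) * norm (Y z)) UNIV"
    by (intro L2_set_mono) (auto simp flip: distrib_left intro!: mult_left_mono norm_triangle_ineq)
  also have "\<dots> \<le> L2_set (\<lambda>z. sqrt (pmf p z) * norm (X z)) UNIV +
      L2_set (\<lambda>z. sqrt (pmf p z) * norm (Y z)) UNIV"
    by (rule L2_set_triangle_ineq)
  finally show ?thesis by (simp only: L2)
qed

text \<open>Young's inequality; the gap between the two sides is exactly
  \<open>(norm (k *\<^sub>R x - y))\<^sup>2 / k\<close>.\<close>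

lemma norm_square_add_le:
  fixes x y :: "'v::real_inner" and k :: real
  assumes "k > 0"
  shows "(norm (x + y))\<^sup>2 \<le> (1 + k) * (norm x)\<^sup>2 + (1 + 1 / k) * (norm y)\<^sup>2"
proof -
  have "0 \<le> (norm (k *\<^sub>R x - y))\<^sup>2 / k" using assms by simp
  also have "\<dots> = (1 + k) * (norm x)\<^sup>2 + (1 + 1 / k) * (norm y)\<^sup>2 - (norm (x + y))\<^sup>2"
    using assms by (simp add: power2_norm_eq_inner inner_diff_left inner_diff_right inner_add_left
        inner_add_right inner_commute divide_simps) (simp add: algebra_simps)
  finally show ?thesis by simp
qed

text \<open>Splitting \<open>G z *v v\<close> into its mean and a centred part turns
  \<open>growth\<close> into the last bound, and Cauchy-Schwarz bounds the norm of
  \<open>A *v v\<close> below by \<open>\<beta> * norm v * q\<close>. Together they force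
  \<open>q\<^sup>2 \<le> q\<close>, and they leave at most
  \<open>\<beta>\<^sup>2 * (norm v)\<^sup>2 * (q - q\<^sup>2)\<close> for the variance.\<close>

lemma coercive_normal_form:
  fixes p :: "'z::finite pmf" and G :: "'z \<Rightarrow> real^'d^'d" and v :: "real^'d" and lam \<beta> :: real
  defines "A \<equiv> measure_pmf.expectation p G"
  assumes pos: "0 < lam" "0 < \<beta>" and "v \<noteq> 0"
    and growth: "measure_pmf.expectation p (\<lambda>z. (norm (G z *v v))\<^sup>2) \<le> \<beta> * (v \<bullet> (A *v v))"
    and coercive: "lam * (norm v)\<^sup>2 \<le> v \<bullet> (A *v v)"
  obtains q where "lam / \<beta> \<le> q" "q \<le> 1" "v \<bullet> (A *v v) = \<beta> * (norm v)\<^sup>2 * q"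
    "\<beta>\<^sup>2 * (norm v)\<^sup>2 * q\<^sup>2 \<le> (norm (A *v v))\<^sup>2"
    "(norm (A *v v))\<^sup>2 + measure_pmf.expectation p (\<lambda>z. (norm ((G z - A) *v v))\<^sup>2)
      \<le> \<beta>\<^sup>2 * (norm v)\<^sup>2 * q"
proof -
  let ?E = "measure_pmf.expectation p"
  define n q S where "n = norm v" and "q = (v \<bullet> (A *v v)) / (\<beta> * n\<^sup>2)"
    and "S = ?E (\<lambda>z. (norm ((G z - A) *v v))\<^sup>2)"
  have n: "n > 0" using \<open>v \<noteq> 0\<close> by (simp add: n_def)
  have Q: "v \<bullet> (A *v v) = \<beta> * n\<^sup>2 * q" using n pos by (simp add: q_def)
  have "(norm (A *v v))\<^sup>2 + S = ?E (\<lambda>z. (norm (A *v v + (G z - A) *v v))\<^sup>2)"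
    unfolding S_def by (rule expectation_norm_square_shift[symmetric])
      (simp add: expectation_matrix_vector_mult A_def)
  also have "\<dots> = ?E (\<lambda>z. (norm (G z *v v))\<^sup>2)"
    by (simp add: matrix_vector_mult_diff_rdistrib)
  finally have NS: "(norm (A *v v))\<^sup>2 + S \<le> \<beta>\<^sup>2 * n\<^sup>2 * q"
    using growth Q by (simp add: power2_eq_square mult_ac)
  have "lam * n\<^sup>2 \<le> \<beta> * q * n\<^sup>2" using coercive Q by (simp add: n_def mult_ac)
  then have yq: "lam / \<beta> \<le> q" using n pos by (simp add: field_simps)
  moreover have "0 < lam / \<beta>" using pos by simp
  ultimately have q0: "0 < q" by linarith
  have "\<beta> * n\<^sup>2 * q \<le> n * norm (A *v v)"
    using norm_cauchy_schwarz[of v "A *v v"] Q by (simp add: n_def)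
  then have "\<beta> * n * q \<le> norm (A *v v)" using n by (simp add: power2_eq_square mult_ac)
  then have "(\<beta> * n * q)\<^sup>2 \<le> (norm (A *v v))\<^sup>2"
    using n pos q0 by (intro power_mono) auto
  then have N: "\<beta>\<^sup>2 * n\<^sup>2 * q\<^sup>2 \<le> (norm (A *v v))\<^sup>2" by (simp add: power_mult_distrib)
  also have "\<dots> \<le> (norm (A *v v))\<^sup>2 + S" by (simp add: S_def)
  finally have "(\<beta>\<^sup>2 * n\<^sup>2 * q) * q \<le> (\<beta>\<^sup>2 * n\<^sup>2 * q) * 1"
    using NS by (simp add: power2_eq_square mult_ac)
  then have "q \<le> 1" using n pos q0 by (subst (asm) mult_le_cancel_left_pos) auto
  then show thesis using that yq Q N NS by (simp add: n_def S_def)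
qed

text \<open>The new error is the deterministic \<open>e - \<alpha> *\<^sub>R (A *v e)\<close> plus a
  centred fluctuation, so their mean squares add. Young's inequality with weight \<open>k\<close>
  separates the part \<open>D\<close> driven by \<open>e\<close> from the part \<open>H\<close>
  driven by \<open>\<theta>\<close> and the noise in \<open>b\<close>. By \<open>param\<close> the
  drift absorbs \<open>D\<close>, while \<open>H\<close> yields the additive constant.\<close>

lemma mean_square_step:
  fixes p :: "'z::finite pmf" and G :: "'z \<Rightarrow> real^'d^'d" and b :: "'z \<Rightarrow> real^'d"
    and \<theta> e :: "real^'d" and lam \<beta> \<alpha> V k :: real
  defines "A \<equiv> measure_pmf.expectation p G" and "bb \<equiv> measure_pmf.expectation p b"
  defines "y \<equiv> lam / \<beta>" and "c \<equiv> \<alpha> * \<beta>\<^sup>2 / lam"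
  defines "w \<equiv> min (17/16) ((5 - y) / 4)"
  assumes pos: "0 < lam" "0 < \<beta>" "0 < \<alpha>" "0 < k"
    and growth: "\<And>v. measure_pmf.expectation p (\<lambda>z. (norm (G z *v v))\<^sup>2) \<le> \<beta> * (v \<bullet> (A *v v))"
    and coercive: "\<And>v. lam * (norm v)\<^sup>2 \<le> v \<bullet> (A *v v)"
    and fixpoint: "A *v \<theta> = bb"
    and noise: "measure_pmf.expectation p (\<lambda>z. (norm (bb - b z))\<^sup>2) \<le> V"
    and param: "\<And>q. y \<le> q \<Longrightarrow> q \<le> 1 \<Longrightarrow> q + k * (q - q\<^sup>2) \<le> (2 * q - y) / (c * y)"
  shows "measure_pmf.expectation p (\<lambda>z. (norm (e + \<alpha> *\<^sub>R (b z - G z *v (e + \<theta>))))\<^sup>2)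
      \<le> (1 - lam * \<alpha>) * (norm e)\<^sup>2 + \<alpha>\<^sup>2 * (w * (1 + 1 / k) * (V + 4 * \<beta>\<^sup>2 * (norm \<theta>)\<^sup>2))"
proof -
  let ?E = "measure_pmf.expectation p"
  have y0: "0 < y" using pos by (simp add: y_def)
  define S where "S v = ?E (\<lambda>z. (norm ((G z - A) *v v))\<^sup>2)" for v
  have centered: "?E (\<lambda>z. (G z - A) *v v) = 0" for v
    by (simp add: expectation_matrix_vector_mult A_def)
  have q: "\<exists>q. y \<le> q \<and> q \<le> 1 \<and> v \<bullet> (A *v v) = \<beta> * (norm v)\<^sup>2 * q
      \<and> \<beta>\<^sup>2 * (norm v)\<^sup>2 * q\<^sup>2 \<le> (norm (A *v v))\<^sup>2
      \<and> (norm (A *v v))\<^sup>2 + S v \<le> \<beta>\<^sup>2 * (norm v)\<^sup>2 * q" if "v \<noteq> 0" for v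
    using coercive_normal_form[of lam \<beta> v p G, folded A_def, OF pos(1,2) that growth coercive]
    unfolding S_def y_def by metis
  \<comment> \<open>Any nonzero vector has some \<open>q\<close> between \<open>y\<close> and 1, so
    a basis vector serves.\<close>
  from q[of "axis undefined 1"] have "y \<le> 1" by (auto simp: axis_eq_0_iff)
  then have w1: "1 \<le> w" by (simp add: w_def)
  \<comment> \<open>Here \<open>4 * (w - 1)\<close> equals \<open>min (1/4) (1 - y)\<close>, which
    dominates \<open>q - q\<^sup>2\<close> for \<open>q\<close> between \<open>y\<close> and
    1.\<close>
  have S\<theta>: "S \<theta> \<le> (w - 1) * (2 * \<beta> * norm \<theta>)\<^sup>2"
  proof (cases "\<theta> = 0")
    case True
    then show ?thesis by (simp add: S_def)
  next
    case False
    with q[of \<theta>] obtain q where q: "y \<le> q" "q \<le> 1" "\<theta> \<bullet> (A *v \<theta>) = \<beta> * (norm \<theta>)\<^sup>2 * q"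
      "\<beta>\<^sup>2 * (norm \<theta>)\<^sup>2 * q\<^sup>2 \<le> (norm (A *v \<theta>))\<^sup>2"
      "(norm (A *v \<theta>))\<^sup>2 + S \<theta> \<le> \<beta>\<^sup>2 * (norm \<theta>)\<^sup>2 * q" by blast
    have "0 \<le> q" using q(1) y0 by simp
    have "0 \<le> (q - 1/2)\<^sup>2" by simp
    then have "q - q\<^sup>2 \<le> 1/4" by (simp add: power2_eq_square algebra_simps)
    moreover have "0 \<le> (1 - q) * (1 - q)" by simp
    then have "q - q\<^sup>2 \<le> 1 - q" by (simp add: power2_eq_square algebra_simps)
    moreover have "w = 17/16 \<or> w = (5 - y) / 4" by (auto simp: w_def min_def)
    ultimately have "q - q\<^sup>2 \<le> 4 * (w - 1)" using q(1) by (elim disjE) simp_all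
    then have "\<beta>\<^sup>2 * (norm \<theta>)\<^sup>2 * (q - q\<^sup>2) \<le> \<beta>\<^sup>2 * (norm \<theta>)\<^sup>2 * (4 * (w - 1))"
      by (intro mult_left_mono) auto
    moreover have "S \<theta> \<le> \<beta>\<^sup>2 * (norm \<theta>)\<^sup>2 * q - \<beta>\<^sup>2 * (norm \<theta>)\<^sup>2 * q\<^sup>2"
      using q(4,5) by simp
    ultimately show ?thesis by (simp add: power2_eq_square algebra_simps)
  qed
  define C where "C = V + 4 * \<beta>\<^sup>2 * (norm \<theta>)\<^sup>2"
  define D H where "D z = (G z - A) *v e" and "H z = (G z - A) *v \<theta> + (bb - b z)" for z
  have V0: "0 \<le> V" using noise by (rule order_trans[rotated]) simp
  have HC: "?E (\<lambda>z. (norm (H z))\<^sup>2) \<le> w * C"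
  proof -
    have "sqrt (?E (\<lambda>z. (norm (H z))\<^sup>2)) \<le> sqrt (S \<theta>) + sqrt (?E (\<lambda>z. (norm (bb - b z))\<^sup>2))"
      unfolding S_def H_def by (rule expectation_norm_square_triangle)
    also have "\<dots> \<le> sqrt ((w - 1) * (2 * \<beta> * norm \<theta>)\<^sup>2) + sqrt V"
      using S\<theta> noise by (intro add_mono real_sqrt_le_mono) auto
    also have "\<dots> = sqrt (w - 1) * (2 * \<beta> * norm \<theta>) + sqrt V"
      using pos by (simp add: real_sqrt_mult)
    finally have "(sqrt (?E (\<lambda>z. (norm (H z))\<^sup>2)))\<^sup>2 \<le> (sqrt (w - 1) * (2 * \<beta> * norm \<theta>) + sqrt V)\<^sup>2"
      by (intro power_mono) auto
    then have "?E (\<lambda>z. (norm (H z))\<^sup>2) \<le> (sqrt (w - 1) * (2 * \<beta> * norm \<theta>) + sqrt V)\<^sup>2" by simp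
    \<comment> \<open>The added square completes Lagrange's identity, which gives Cauchy-Schwarz
      with the factor \<open>1 + (sqrt (w - 1))\<^sup>2 = w\<close>.\<close>
    also have "\<dots> \<le> (sqrt (w - 1) * (2 * \<beta> * norm \<theta>) + sqrt V)\<^sup>2
        + (2 * \<beta> * norm \<theta> - sqrt (w - 1) * sqrt V)\<^sup>2" by simp
    also have "\<dots> = (1 + (sqrt (w - 1))\<^sup>2) * ((2 * \<beta> * norm \<theta>)\<^sup>2 + (sqrt V)\<^sup>2)"
      by (simp only: power2_eq_square) algebra
    also have "\<dots> = w * C" using w1 V0 by (simp add: C_def power_mult_distrib)
    finally show ?thesis .
  qed
  have "?E (\<lambda>z. (norm (D z + H z))\<^sup>2) \<le>
      ?E (\<lambda>z. (1 + k) * (norm (D z))\<^sup>2 + (1 + 1 / k) * (norm (H z))\<^sup>2)"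
    using pos by (intro integral_mono norm_square_add_le) auto
  also have "\<dots> = (1 + k) * S e + (1 + 1 / k) * ?E (\<lambda>z. (norm (H z))\<^sup>2)"
    by (simp add: S_def D_def)
  also have "\<dots> \<le> (1 + k) * S e + (1 + 1 / k) * (w * C)"
    using HC pos by (intro add_left_mono mult_left_mono) auto
  finally have DH: "?E (\<lambda>z. (norm (D z + H z))\<^sup>2) \<le> (1 + k) * S e + (1 + 1 / k) * (w * C)" .
  \<comment> \<open>Since \<open>c * y = \<alpha> * \<beta>\<close> and
    \<open>\<beta> * y = lam\<close>, the right-hand side is that of \<open>param\<close> multiplied
    by \<open>\<alpha> * \<beta>\<^sup>2 * (norm e)\<^sup>2\<close>.\<close>
  have main: "\<alpha> * ((norm (A *v e))\<^sup>2 + (1 + k) * S e) \<le> 2 * (e \<bullet> (A *v e)) - lam * (norm e)\<^sup>2"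
  proof (cases "e = 0")
    case True
    then show ?thesis by (simp add: S_def)
  next
    case False
    with q[of e] obtain q where q: "y \<le> q" "q \<le> 1" "e \<bullet> (A *v e) = \<beta> * (norm e)\<^sup>2 * q"
      "\<beta>\<^sup>2 * (norm e)\<^sup>2 * q\<^sup>2 \<le> (norm (A *v e))\<^sup>2"
      "(norm (A *v e))\<^sup>2 + S e \<le> \<beta>\<^sup>2 * (norm e)\<^sup>2 * q" by blast
    note Se = q(5)
    then have "S e \<le> \<beta>\<^sup>2 * (norm e)\<^sup>2 * (q - q\<^sup>2)" using q(4) by (simp add: algebra_simps)
    then have "k * S e \<le> k * (\<beta>\<^sup>2 * (norm e)\<^sup>2 * (q - q\<^sup>2))" using pos by (intro mult_left_mono) auto
    with Se have "(norm (A *v e))\<^sup>2 + (1 + k) * S e \<le> \<beta>\<^sup>2 * (norm e)\<^sup>2 * (q + k * (q - q\<^sup>2))"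
      by (simp add: algebra_simps)
    also have "\<dots> \<le> \<beta>\<^sup>2 * (norm e)\<^sup>2 * ((2 * q - y) / (c * y))"
      using param[OF q(1,2)] by (intro mult_left_mono) auto
    finally have "\<alpha> * ((norm (A *v e))\<^sup>2 + (1 + k) * S e) \<le> \<alpha> * (\<beta>\<^sup>2 * (norm e)\<^sup>2 * ((2 * q - y) / (c * y)))"
      using pos by (intro mult_left_mono) auto
    also have "\<dots> = 2 * (e \<bullet> (A *v e)) - lam * (norm e)\<^sup>2"
      unfolding q(3) using pos by (simp add: c_def y_def field_simps power2_eq_square)
    finally show ?thesis .
  qed
  have "?E (\<lambda>z. (norm (e + \<alpha> *\<^sub>R (b z - G z *v (e + \<theta>))))\<^sup>2)
      = ?E (\<lambda>z. (norm ((e - \<alpha> *\<^sub>R (A *v e)) + (- \<alpha>) *\<^sub>R (D z + H z)))\<^sup>2)"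
  proof -
    have "e + \<alpha> *\<^sub>R (b z - G z *v (e + \<theta>)) = (e - \<alpha> *\<^sub>R (A *v e)) + (- \<alpha>) *\<^sub>R (D z + H z)" for z
      unfolding D_def H_def fixpoint[symmetric]
      by (simp add: matrix_vector_mult_diff_rdistrib matrix_vector_right_distrib algebra_simps)
    then show ?thesis by (simp only:)
  qed
  also have "\<dots> = (norm (e - \<alpha> *\<^sub>R (A *v e)))\<^sup>2 + ?E (\<lambda>z. (norm ((- \<alpha>) *\<^sub>R (D z + H z)))\<^sup>2)"
    by (rule expectation_norm_square_shift) (simp add: D_def H_def centered bb_def)
  also have "\<dots> = (norm e)\<^sup>2 - 2 * \<alpha> * (e \<bullet> (A *v e)) + \<alpha>\<^sup>2 * (norm (A *v e))\<^sup>2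
      + \<alpha>\<^sup>2 * ?E (\<lambda>z. (norm (D z + H z))\<^sup>2)"
  proof -
    have "(norm (e - \<alpha> *\<^sub>R (A *v e)))\<^sup>2 = (norm e)\<^sup>2 - 2 * \<alpha> * (e \<bullet> (A *v e)) + \<alpha>\<^sup>2 * (norm (A *v e))\<^sup>2"
      unfolding power2_norm_eq_inner
      by (simp add: inner_diff_left inner_diff_right inner_commute power2_eq_square)
    moreover have "(norm ((- \<alpha>) *\<^sub>R x))\<^sup>2 = \<alpha>\<^sup>2 * (norm x)\<^sup>2" for x :: "real^'d"
      by (simp only: norm_scaleR power_mult_distrib power2_abs power2_minus)
    ultimately show ?thesis by (simp only: integral_mult_right_zero)
  qed
  also have "\<dots> \<le> (norm e)\<^sup>2 - 2 * \<alpha> * (e \<bullet> (A *v e)) + \<alpha>\<^sup>2 * (norm (A *v e))\<^sup>2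
      + \<alpha>\<^sup>2 * ((1 + k) * S e + (1 + 1 / k) * (w * C))"
    using DH by (intro add_left_mono mult_left_mono) auto
  also have "\<dots> = (norm e)\<^sup>2 - 2 * \<alpha> * (e \<bullet> (A *v e)) + \<alpha> * (\<alpha> * ((norm (A *v e))\<^sup>2 + (1 + k) * S e))
      + \<alpha>\<^sup>2 * (w * (1 + 1 / k) * C)"
    by (simp add: power2_eq_square algebra_simps)
  also have "\<dots> \<le> (norm e)\<^sup>2 - 2 * \<alpha> * (e \<bullet> (A *v e)) + \<alpha> * (2 * (e \<bullet> (A *v e)) - lam * (norm e)\<^sup>2)
      + \<alpha>\<^sup>2 * (w * (1 + 1 / k) * C)"
    using main pos by (intro add_right_mono add_left_mono mult_left_mono) auto
  also have "\<dots> = (1 - lam * \<alpha>) * (norm e)\<^sup>2 + \<alpha>\<^sup>2 * (w * (1 + 1 / k) * C)"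
    by (simp add: algebra_simps)
  finally show "?E (\<lambda>z. (norm (e + \<alpha> *\<^sub>R (b z - G z *v (e + \<theta>))))\<^sup>2)
      \<le> (1 - lam * \<alpha>) * (norm e)\<^sup>2 + \<alpha>\<^sup>2 * (w * (1 + 1 / k) * (V + 4 * \<beta>\<^sup>2 * (norm \<theta>)\<^sup>2))"
    by (simp add: C_def)
qed

section \<open>The TD(0) recursion\<close>

lemma td_A_mult: "td_A \<gamma> \<phi> (s, a, s') *v v = (\<phi> s \<bullet> v - \<gamma> * (\<phi> s' \<bullet> v)) *\<^sub>R \<phi> s"
  by (simp add: td_A_def vec_eq_iff matrix_vector_mult_def inner_vec_def sum_distrib_left
      sum_distrib_right sum_subtractf algebra_simps)

lemma expectation_tuple_fst:
  fixes g :: "'s::finite \<Rightarrow> real"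
  shows "measure_pmf.expectation (tuple_pmf \<mu> \<pi> P) (\<lambda>z. g (fst z)) = measure_pmf.expectation \<mu> g"
proof -
  have "map_pmf fst (tuple_pmf \<mu> \<pi> P) = \<mu>"
    by (simp add: tuple_pmf_def map_bind_pmf pmf.map_comp o_def bind_return_pmf' map_pmf_const)
  then show ?thesis by (metis integral_map_pmf)
qed

lemma expectation_tuple_next:
  fixes g :: "'s::finite \<Rightarrow> real"
  assumes "stationary (induced_kernel \<pi> P) \<mu>"
  shows "measure_pmf.expectation (tuple_pmf \<mu> \<pi> P) (\<lambda>z. g (snd (snd z))) = measure_pmf.expectation \<mu> g"
proof -
  have "map_pmf (\<lambda>z. snd (snd z)) (tuple_pmf \<mu> \<pi> P) = bind_pmf \<mu> (induced_kernel \<pi> P)"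
    by (simp add: tuple_pmf_def induced_kernel_def[abs_def] map_bind_pmf pmf.map_comp o_def)
  also have "\<dots> = \<mu>" using assms by (simp add: stationary_def)
  finally show ?thesis by (metis integral_map_pmf)
qed

text \<open>Stationarity gives \<open>u(S)\<close> and \<open>u(S\<^sup>+)\<close>, with \<open>u = \<phi> \<bullet> v\<close>, the same second moment, so the
  difference of the two sides is at least \<open>\<gamma> (1 - \<gamma>) / 2\<close> times the mean of \<open>(u(S) + u(S\<^sup>+))\<^sup>2\<close>.\<close>

lemma td_A_growth:
  fixes \<phi> :: "'s::finite \<Rightarrow> real^'d" and \<pi> :: "'s \<Rightarrow> ('n::finite \<Rightarrow> 'a::finite) pmf"
    and P :: "('n \<Rightarrow> 'a) \<Rightarrow> 's \<Rightarrow> 's pmf" and \<mu> :: "'s pmf" and \<gamma> :: real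
  defines "A \<equiv> measure_pmf.expectation (tuple_pmf \<mu> \<pi> P) (td_A \<gamma> \<phi>)"
  assumes stat: "stationary (induced_kernel \<pi> P) \<mu>" and \<gamma>: "0 \<le> \<gamma>" "\<gamma> \<le> 1"
    and \<phi>: "\<And>s. norm (\<phi> s) \<le> 1"
  shows "measure_pmf.expectation (tuple_pmf \<mu> \<pi> P) (\<lambda>z. (norm (td_A \<gamma> \<phi> z *v v))\<^sup>2)
    \<le> (1 + \<gamma>) * (v \<bullet> (A *v v))"
proof -
  let ?E = "measure_pmf.expectation (tuple_pmf \<mu> \<pi> P)"
  define u where "u s = \<phi> s \<bullet> v" for s
  define m where "m = measure_pmf.expectation \<mu> (\<lambda>s. (u s)\<^sup>2)"
  define c where "c = ?E (\<lambda>z. u (fst z) * u (snd (snd z)))"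
  have m: "?E (\<lambda>z. (u (fst z))\<^sup>2) = m" "?E (\<lambda>z. (u (snd (snd z)))\<^sup>2) = m"
    unfolding m_def by (rule expectation_tuple_fst expectation_tuple_next[OF stat])+
  have "?E (\<lambda>z. (norm (td_A \<gamma> \<phi> z *v v))\<^sup>2) \<le>
      ?E (\<lambda>z. (u (fst z))\<^sup>2 - 2 * \<gamma> * (u (fst z) * u (snd (snd z))) + \<gamma>\<^sup>2 * (u (snd (snd z)))\<^sup>2)"
  proof (intro integral_mono)
    fix z :: "'s \<times> ('n \<Rightarrow> 'a) \<times> 's"
    obtain s a s' where z: "z = (s, a, s')" by (metis prod_cases3)
    have "(norm (td_A \<gamma> \<phi> z *v v))\<^sup>2 = (u s - \<gamma> * u s')\<^sup>2 * (norm (\<phi> s))\<^sup>2"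
      by (simp add: z td_A_mult u_def power_mult_distrib)
    also have "\<dots> \<le> (u s - \<gamma> * u s')\<^sup>2 * 1"
      using \<phi>[of s] by (intro mult_left_mono) (auto simp: power_le_one)
    finally show "(norm (td_A \<gamma> \<phi> z *v v))\<^sup>2
        \<le> (u (fst z))\<^sup>2 - 2 * \<gamma> * (u (fst z) * u (snd (snd z))) + \<gamma>\<^sup>2 * (u (snd (snd z)))\<^sup>2"
      by (simp add: z power2_eq_square algebra_simps)
  qed simp_all
  also have "\<dots> = m - 2 * \<gamma> * c + \<gamma>\<^sup>2 * m"
    by (simp add: m c_def)
  also have "\<dots> \<le> (1 + \<gamma>) * (m - \<gamma> * c)"
  proof -
    have "0 \<le> ?E (\<lambda>z. (u (fst z) + u (snd (snd z)))\<^sup>2)" by simp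
    also have "\<dots> = 2 * (m + c)"
      by (simp add: power2_sum m c_def mult.assoc)
    finally have "0 \<le> \<gamma> * (1 - \<gamma>) * (m + c)" using \<gamma> by simp
    then show ?thesis by (simp add: power2_eq_square algebra_simps)
  qed
  also have "m - \<gamma> * c = v \<bullet> (A *v v)"
  proof -
    have "v \<bullet> (A *v v) = ?E (\<lambda>z. v \<bullet> (td_A \<gamma> \<phi> z *v v))"
      by (simp add: A_def flip: expectation_matrix_vector_mult)
    also have "(\<lambda>z :: 's \<times> ('n \<Rightarrow> 'a) \<times> 's. v \<bullet> (td_A \<gamma> \<phi> z *v v)) =
        (\<lambda>z. (u (fst z))\<^sup>2 - \<gamma> * (u (fst z) * u (snd (snd z))))"
      by (auto simp: fun_eq_iff td_A_mult u_def inner_commute[of v] power2_eq_square algebra_simps)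
    finally show ?thesis by (simp add: m c_def)
  qed
  finally show ?thesis .
qed

text \<open>Unit column sums make the mixing preserve the sum over the agents. The local updates
  share one tuple and are affine in the iterates, so they average to a single TD(0) update with the
  averaged reward.\<close>

lemma agent_avg_td_iterate_Suc:
  fixes \<phi> :: "'s \<Rightarrow> real^'d" and r :: "'n::finite \<Rightarrow> 's \<Rightarrow> 'b \<Rightarrow> real"
  assumes W: "\<And>j. (\<Sum>i\<in>UNIV. W $ i $ j) = 1"
  shows "agent_avg (td_iterate W \<alpha> \<gamma> \<phi> r \<theta>0 z (Suc t)) =
    agent_avg (td_iterate W \<alpha> \<gamma> \<phi> r \<theta>0 z t) + \<alpha> (Suc t) *\<^sub>R
      (td_bbar \<phi> r (z (Suc t)) - td_A \<gamma> \<phi> (z (Suc t)) *v agent_avg (td_iterate W \<alpha> \<gamma> \<phi> r \<theta>0 z t))"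
proof -
  define x where "x = td_iterate W \<alpha> \<gamma> \<phi> r \<theta>0 z t"
  obtain s a s' where z: "z (Suc t) = (s, a, s')" by (metis prod_cases3)
  have mix: "(\<Sum>i\<in>UNIV. \<Sum>j\<in>UNIV. W $ i $ j *\<^sub>R x j) = (\<Sum>j\<in>UNIV. x j)"
    by (subst sum.swap) (simp add: W flip: scaleR_sum_left)
  have "(\<Sum>i\<in>UNIV. td_iterate W \<alpha> \<gamma> \<phi> r \<theta>0 z (Suc t) i) = (\<Sum>j\<in>UNIV. x j) +
      (\<Sum>i\<in>UNIV. (\<alpha> (Suc t) * (r i s a + (\<gamma> *\<^sub>R \<phi> s' - \<phi> s) \<bullet> x i)) *\<^sub>R \<phi> s)"
    by (simp add: z sum.distrib flip: x_def mix)
  also have "(\<Sum>i\<in>UNIV. (\<alpha> (Suc t) * (r i s a + (\<gamma> *\<^sub>R \<phi> s' - \<phi> s) \<bullet> x i)) *\<^sub>R \<phi> s) =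
      (\<alpha> (Suc t) * ((\<Sum>i\<in>UNIV. r i s a) + (\<gamma> *\<^sub>R \<phi> s' - \<phi> s) \<bullet> (\<Sum>i\<in>UNIV. x i))) *\<^sub>R \<phi> s"
    by (simp only: scaleR_sum_left[symmetric] sum_distrib_left[symmetric] sum.distrib inner_sum_right)
  finally have "agent_avg (td_iterate W \<alpha> \<gamma> \<phi> r \<theta>0 z (Suc t)) = agent_avg x +
      (1 / real CARD('n)) *\<^sub>R ((\<alpha> (Suc t) * ((\<Sum>i\<in>UNIV. r i s a) +
        (\<gamma> *\<^sub>R \<phi> s' - \<phi> s) \<bullet> (\<Sum>i\<in>UNIV. x i))) *\<^sub>R \<phi> s)"
    by (simp add: agent_avg_def scaleR_right_distrib)
  also have "(1 / real CARD('n)) *\<^sub>R ((\<alpha> (Suc t) * ((\<Sum>i\<in>UNIV. r i s a) +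
        (\<gamma> *\<^sub>R \<phi> s' - \<phi> s) \<bullet> (\<Sum>i\<in>UNIV. x i))) *\<^sub>R \<phi> s) =
      \<alpha> (Suc t) *\<^sub>R (td_bbar \<phi> r (z (Suc t)) - td_A \<gamma> \<phi> (z (Suc t)) *v agent_avg x)"
    by (simp add: z td_A_mult td_bbar_def td_b_def agent_avg_def scaleR_sum_left[symmetric]
        inner_diff_left algebra_simps flip: scaleR_diff_left scaleR_add_left)
  finally show ?thesis by (simp only: x_def)
qed

section \<open>Independence of the next sample from the past\<close>

lemma td_iterate_cong:
  assumes "\<And>i. i \<in> {1..t} \<Longrightarrow> z i = z' i"
  shows "td_iterate W \<alpha> \<gamma> \<phi> r \<theta>0 z t = td_iterate W \<alpha> \<gamma> \<phi> r \<theta>0 z' t"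
  using assms by (induction t) auto

text \<open>This does the work of conditioning on the past. Samples take finitely many values, so
  the integrand is a finite sum of products of a function of the past with an indicator of the next
  sample, and each expectation factors by independence.\<close>

lemma (in prob_space) past_next_expectation:
  fixes \<zeta> :: "nat \<Rightarrow> 'a \<Rightarrow> 'z::finite" and f :: "(nat \<Rightarrow> 'z) \<Rightarrow> real" and h :: "(nat \<Rightarrow> 'z) \<Rightarrow> 'z \<Rightarrow> real"
  defines "past \<equiv> \<lambda>t \<omega>. restrict (\<lambda>i. \<zeta> i \<omega>) {1..t}"
  assumes ind: "indep_vars (\<lambda>_. count_space UNIV) \<zeta> {1..}"
    and law: "distr M (count_space UNIV) (\<zeta> (Suc t)) = measure_pmf p"
  shows integrable_past: "integrable M (\<lambda>\<omega>. f (past t \<omega>))"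
    and expectation_past_next: "expectation (\<lambda>\<omega>. h (past t \<omega>) (\<zeta> (Suc t) \<omega>)) =
      expectation (\<lambda>\<omega>. measure_pmf.expectation p (h (past t \<omega>)))"
proof -
  let ?C = "count_space UNIV :: 'z measure"
  have meas: "\<zeta> i \<in> measurable M ?C" if "i \<ge> 1" for i
    using ind that by (auto simp: indep_vars_def)
  \<comment> \<open>A finite product of finite discrete spaces is discrete, so every real function
    of the past is measurable and bounded.\<close>
  have PiM: "PiM {1..t} (\<lambda>_. ?C) = count_space (PiE {1..t} (\<lambda>_. UNIV))"
    by (rule count_space_PiM_finite) auto
  have past_meas: "past t \<in> measurable M (PiM {1..t} (\<lambda>_. ?C))"
    unfolding past_def by (intro measurable_restrict meas) simp
  have f_meas: "g \<in> borel_measurable (PiM {1..t} (\<lambda>_. ?C))" for g :: "(nat \<Rightarrow> 'z) \<Rightarrow> real"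
    unfolding PiM by simp
  have int: "integrable M (\<lambda>\<omega>. g (past t \<omega>))" for g :: "(nat \<Rightarrow> 'z) \<Rightarrow> real"
  proof -
    have "finite ((\<lambda>x. \<bar>g x\<bar>) ` PiE {1..t} (\<lambda>_. UNIV))"
      by (intro finite_imageI finite_PiE) auto
    then have "norm (g (past t \<omega>)) \<le> Max ((\<lambda>x. \<bar>g x\<bar>) ` PiE {1..t} (\<lambda>_. UNIV))" for \<omega>
      by (auto simp: past_def intro!: Max_ge imageI)
    then show ?thesis
      by (intro integrable_const_bound AE_I2 measurable_compose[OF past_meas f_meas]) auto
  qed
  then show "integrable M (\<lambda>\<omega>. f (past t \<omega>))" .
  have h_int: "integrable M (\<lambda>\<omega>. h (past t \<omega>) z)" for z
    by (rule int)
  have next_meas: "(\<lambda>\<omega>. indicator {z} (\<zeta> (Suc t) \<omega>) :: real) \<in> borel_measurable M" for z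
    by (rule measurable_compose[OF meas]) simp_all
  have next_int: "integrable M (\<lambda>\<omega>. indicator {z} (\<zeta> (Suc t) \<omega>) :: real)" for z
    by (intro integrable_const_bound[where B = 1] next_meas) (simp split: split_indicator)
  have next_exp: "expectation (\<lambda>\<omega>. indicator {z} (\<zeta> (Suc t) \<omega>)) = pmf p z" for z
  proof -
    have "expectation (\<lambda>\<omega>. indicator {z} (\<zeta> (Suc t) \<omega>) :: real) =
        integral\<^sup>L (distr M ?C (\<zeta> (Suc t))) (indicator {z})"
      by (rule integral_distr[symmetric]) (simp_all add: meas)
    then show ?thesis by (simp add: law pmf.rep_eq)
  qed
  have indep: "indep_var borel (\<lambda>\<omega>. h (past t \<omega>) z) borel (\<lambda>\<omega>. indicator {z} (\<zeta> (Suc t) \<omega>) :: real)" for z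
  proof -
    have "indep_var (PiM {1..t} (\<lambda>_. ?C)) (past t)
        (PiM {Suc t} (\<lambda>_. ?C)) (\<lambda>\<omega>. restrict (\<lambda>i. \<zeta> i \<omega>) {Suc t})"
      unfolding past_def by (rule indep_var_restrict[OF ind]) auto
    then have "indep_var borel ((\<lambda>x. h x z) \<circ> past t)
        borel ((\<lambda>x. indicator {z} (x (Suc t)) :: real) \<circ> (\<lambda>\<omega>. restrict (\<lambda>i. \<zeta> i \<omega>) {Suc t}))"
    proof (rule indep_var_compose)
      show "(\<lambda>x. indicator {z} (x (Suc t)) :: real) \<in> borel_measurable (PiM {Suc t} (\<lambda>_. ?C))"
        by (rule measurable_compose[OF measurable_component_singleton[of "Suc t"]]) simp_all
    qed (rule f_meas)
    then show ?thesis by (simp add: o_def)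
  qed
  have "expectation (\<lambda>\<omega>. h (past t \<omega>) (\<zeta> (Suc t) \<omega>)) =
      expectation (\<lambda>\<omega>. \<Sum>z\<in>UNIV. h (past t \<omega>) z * indicator {z} (\<zeta> (Suc t) \<omega>))"
    by (simp add: indicator_def of_bool_def if_distrib cong: if_cong)
  also have "\<dots> = (\<Sum>z\<in>UNIV. expectation (\<lambda>\<omega>. h (past t \<omega>) z) * pmf p z)"
    by (subst Bochner_Integration.integral_sum)
      (simp_all add: indep_var_integrable[OF indep h_int next_int]
        indep_var_lebesgue_integral[OF indep h_int next_int] next_exp)
  also have "\<dots> = expectation (\<lambda>\<omega>. \<Sum>z\<in>UNIV. h (past t \<omega>) z * pmf p z)"
    by (subst Bochner_Integration.integral_sum) (simp_all add: h_int)
  also have "\<dots> = expectation (\<lambda>\<omega>. measure_pmf.expectation p (h (past t \<omega>)))"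
    by (subst integral_measure_pmf_real[of UNIV]) auto
  finally show "expectation (\<lambda>\<omega>. h (past t \<omega>) (\<zeta> (Suc t) \<omega>)) =
      expectation (\<lambda>\<omega>. measure_pmf.expectation p (h (past t \<omega>)))" .
qed

text \<open>The old level \<open>(2 / l) * C * \<alpha> k\<close> is rewritten through
  \<open>\<rho>\<close> in terms of the new step size. Up to the factor
  \<open>C * \<alpha> k / l\<close>, \<open>balance\<close> says that one contraction plus fresh
  noise stays below the new level.\<close>

lemma recursion_bound:
  fixes E \<alpha> \<kappa> \<rho> :: "nat \<Rightarrow> real" and l C :: real
  assumes l: "0 < l" and C: "0 \<le> C"
    and \<alpha>: "\<And>k. 1 \<le> k \<Longrightarrow> 0 < \<alpha> k" "\<And>k. 1 \<le> k \<Longrightarrow> l * \<alpha> k \<le> 1"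
    and step: "\<And>k. E (Suc k) \<le> (1 - l * \<alpha> (Suc k)) * E k + (\<alpha> (Suc k))\<^sup>2 * (\<kappa> (Suc k) * C)"
    and \<rho>: "\<And>k. 1 \<le> k \<Longrightarrow> 0 \<le> \<rho> k" "\<And>k. 1 \<le> k \<Longrightarrow> \<alpha> k \<le> \<rho> (Suc k) * \<alpha> (Suc k)"
    and balance: "\<And>k. 1 \<le> k \<Longrightarrow> 2 * (1 - l * \<alpha> k) * \<rho> k + l * \<alpha> k * \<kappa> k \<le> 2"
    and "1 \<le> k"
  shows "E k \<le> (\<Prod>i=1..k. 1 - l * \<alpha> i) * E 0 + (2 / l) * C * \<alpha> k"
proof -
  have noise: "(1 - l * \<alpha> k) * ((2 / l) * C * (\<rho> k * \<alpha> k)) + (\<alpha> k)\<^sup>2 * (\<kappa> k * C) \<le> (2 / l) * C * \<alpha> k"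
    if "1 \<le> k" for k
  proof -
    have "(1 - l * \<alpha> k) * ((2 / l) * C * (\<rho> k * \<alpha> k)) + (\<alpha> k)\<^sup>2 * (\<kappa> k * C) =
        (C * \<alpha> k / l) * (2 * (1 - l * \<alpha> k) * \<rho> k + l * \<alpha> k * \<kappa> k)"
      using l by (simp add: field_simps power2_eq_square)
    also have "\<dots> \<le> (C * \<alpha> k / l) * 2"
      using balance[OF that] \<alpha>(1)[OF that] l C by (intro mult_left_mono) auto
    finally show ?thesis by (simp add: mult_ac)
  qed
  show ?thesis using \<open>1 \<le> k\<close>
  proof (induction k rule: dec_induct)
    case base
    \<comment> \<open>No earlier noise exists at the first step, so the first summand in
      \<open>noise\<close> is dropped as nonnegative.\<close>
    have "0 \<le> (1 - l * \<alpha> 1) * ((2 / l) * C * (\<rho> 1 * \<alpha> 1))"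
      using \<alpha>[of 1] \<rho>(1)[of 1] l C by simp
    with noise[of 1] step[of 0] show ?case by simp
  next
    case (step k)
    have "E (Suc k) \<le> (1 - l * \<alpha> (Suc k)) * E k + (\<alpha> (Suc k))\<^sup>2 * (\<kappa> (Suc k) * C)"
      by (rule assms(5))
    also have "\<dots> \<le> (1 - l * \<alpha> (Suc k)) * ((\<Prod>i=1..k. 1 - l * \<alpha> i) * E 0
        + (2 / l) * C * (\<rho> (Suc k) * \<alpha> (Suc k))) + (\<alpha> (Suc k))\<^sup>2 * (\<kappa> (Suc k) * C)"
    proof -
      have "(2 / l) * C * \<alpha> k \<le> (2 / l) * C * (\<rho> (Suc k) * \<alpha> (Suc k))"
        using \<rho>(2)[of k] step.hyps l C by (intro mult_left_mono) auto
      with step.IH have "E k \<le> (\<Prod>i=1..k. 1 - l * \<alpha> i) * E 0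
          + (2 / l) * C * (\<rho> (Suc k) * \<alpha> (Suc k))" by linarith
      then show ?thesis using \<alpha>(2)[of "Suc k"] by (intro add_right_mono mult_left_mono) auto
    qed
    also have "\<dots> \<le> (\<Prod>i=1..Suc k. 1 - l * \<alpha> i) * E 0 + (2 / l) * C * \<alpha> (Suc k)"
      using noise[of "Suc k"] by (simp add: distrib_left mult_ac)
    finally show ?case .
  qed
qed

theorem theorem3:
  fixes Act :: "'n::finite \<Rightarrow> 'a::finite set"
    and P :: "('n \<Rightarrow> 'a) \<Rightarrow> 's::finite \<Rightarrow> 's pmf"
    and \<pi> :: "'s \<Rightarrow> ('n \<Rightarrow> 'a) pmf"
    and \<mu> :: "'s pmf"
    and r :: "'n \<Rightarrow> 's \<Rightarrow> ('n \<Rightarrow> 'a) \<Rightarrow> real"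
    and \<phi> :: "'s \<Rightarrow> real^'d"
    and \<gamma> Rmax \<beta> \<sigma> lmin :: real
    and E :: "('n \<times> 'n) set"
    and W :: "real^'n^'n"
    and \<alpha> :: "nat \<Rightarrow> real"
    and \<theta>0 :: "'n \<Rightarrow> real^'d"
    and A :: "real^'d^'d"
    and bbar \<theta>star :: "real^'d"
    and M :: "'w measure"
    and \<zeta> :: "nat \<Rightarrow> 'w \<Rightarrow> 's \<times> ('n \<Rightarrow> 'a) \<times> 's"
    and \<theta>bar :: "nat \<Rightarrow> 'w \<Rightarrow> real^'d"
    and t :: nat
  assumes policy: "\<And>s. set_pmf (\<pi> s) \<subseteq> joint_actions Act"
    and discount: "0 < \<gamma>" "\<gamma> < 1"
    and reward_nonneg: "\<And>i s a. a \<in> joint_actions Act \<Longrightarrow> 0 \<le> r i s a"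
    and graph: "undirected_connected_graph E"
    and mixing: "doubly_stochastic_mixing E W"
    and step_pos: "\<And>k. k \<ge> 1 \<Longrightarrow> 0 < \<alpha> k"
    and invariant: "unique_stationary (induced_kernel \<pi> P) \<mu>"
    and prob: "prob_space M"
    and indep: "prob_space.indep_vars M (\<lambda>_. count_space UNIV) \<zeta> {1..}"
    and ident: "\<And>k. k \<ge> 1 \<Longrightarrow>
       distr M (count_space UNIV) (\<zeta> k) = measure_pmf (tuple_pmf \<mu> \<pi> P)"
    and \<theta>bar_def: "\<And>k \<omega>.
       \<theta>bar k \<omega> = agent_avg (td_iterate W \<alpha> \<gamma> \<phi> r \<theta>0 (\<lambda>m. \<zeta> m \<omega>) k)"
    and feature_bound: "\<And>s. norm (\<phi> s) \<le> 1"
    and reward_bound: "\<And>i s a. a \<in> joint_actions Act \<Longrightarrow> \<bar>r i s a\<bar> \<le> Rmax"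
    and A_def: "A = measure_pmf.expectation (tuple_pmf \<mu> \<pi> P) (td_A \<gamma> \<phi>)"
    and bbar_def: "bbar = measure_pmf.expectation (tuple_pmf \<mu> \<pi> P) (td_bbar \<phi> r)"
    and full_rank: "rank A = CARD('d)"
    and hurwitz: "hurwitz (- A)"
    and \<theta>star: "A *v \<theta>star = bbar"
    and lmin_def: "lmin = min_eigenvalue ((1/2) *\<^sub>R (A + transpose A))"
    and \<beta>_def: "\<beta> = 1 + \<gamma>"
    and \<sigma>_def: "\<sigma>\<^sup>2 = 2 * Rmax\<^sup>2"
    and noise_bound: "measure_pmf.expectation (tuple_pmf \<mu> \<pi> P)
         (\<lambda>z. (norm (bbar - td_bbar \<phi> r z))\<^sup>2) \<le> \<sigma>\<^sup>2 / real CARD('n)"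
    and step_ratio: "\<And>k. k \<ge> 1 \<Longrightarrow> \<alpha> k / \<alpha> (k + 1) \<le> sqrt (1 + (lmin / 2) * \<alpha> (k + 1))"
    and step_bound: "\<And>k. k \<ge> 1 \<Longrightarrow> \<alpha> k \<le> lmin / \<beta>\<^sup>2"
    and "t \<ge> 1"
  shows "prob_space.expectation M (\<lambda>\<omega>. (norm (\<theta>bar (t + 1) \<omega> - \<theta>star))\<^sup>2)
       \<le> (\<Prod>i=1..t+1. 1 - lmin * \<alpha> i) * (norm (agent_avg \<theta>0 - \<theta>star))\<^sup>2
         + (2 / lmin) * (\<sigma>\<^sup>2 / real CARD('n) + 4 * \<beta>\<^sup>2 * (norm \<theta>star)\<^sup>2) * \<alpha> (t + 1)"
proof -
  interpret prob_space M by (rule prob)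
  let ?p = "tuple_pmf \<mu> \<pi> P"
  define y where "y = lmin / \<beta>"
  define c where "c k = \<alpha> k * \<beta>\<^sup>2 / lmin" for k
  define C where "C = \<sigma>\<^sup>2 / real CARD('n) + 4 * \<beta>\<^sup>2 * (norm \<theta>star)\<^sup>2"
  define err where "err k = expectation (\<lambda>\<omega>. (norm (\<theta>bar k \<omega> - \<theta>star))\<^sup>2)" for k
  have \<beta>: "0 < \<beta>" using discount by (simp add: \<beta>_def)
  \<comment> \<open>Positivity of \<open>lmin\<close> is read off from \<open>0 < \<alpha> 1\<close>
    and \<open>\<alpha> 1 \<le> lmin / \<beta>\<^sup>2\<close>.\<close>
  have "0 < lmin / \<beta>\<^sup>2" using step_pos[of 1] step_bound[of 1] by simp
  then have lmin: "0 < lmin" using \<beta> by (simp add: zero_less_divide_iff)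
  have y0: "0 < y" using lmin \<beta> by (simp add: y_def)
  have C: "0 \<le> C" by (simp add: C_def)
  have c: "0 < c k" "c k \<le> 1" if "1 \<le> k" for k
    using step_pos[OF that] step_bound[OF that] lmin \<beta> by (simp_all add: c_def field_simps)
  have cy: "c k * y\<^sup>2 = lmin * \<alpha> k" for k
    using lmin \<beta> by (simp add: c_def y_def power2_eq_square)
  have coercive: "lmin * (norm v)\<^sup>2 \<le> v \<bullet> (A *v v)" for v
    unfolding lmin_def by (rule min_eigenvalue_symmetric_part)
  have growth: "measure_pmf.expectation ?p (\<lambda>z. (norm (td_A \<gamma> \<phi> z *v v))\<^sup>2) \<le> \<beta> * (v \<bullet> (A *v v))" for v
    unfolding A_def \<beta>_def using invariant discount feature_bound
    by (intro td_A_growth) (auto simp: unique_stationary_def)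
  have y1: "y \<le> 1"
  proof -
    have "axis undefined 1 \<noteq> (0 :: real^'d)" by (simp add: axis_eq_0_iff)
    from coercive_normal_form[of lmin \<beta> "axis undefined 1" ?p "td_A \<gamma> \<phi>", folded A_def,
        OF lmin \<beta> this growth coercive]
    show ?thesis unfolding y_def by (metis order_trans)
  qed
  \<comment> \<open>The bound \<open>1 / c k\<close> on the step ratio comes from
    \<open>step_bound\<close> at the preceding index, the other one from
    \<open>step_ratio\<close>.\<close>
  define \<rho> where "\<rho> k = min (1 / c k) (1 + c k * y\<^sup>2 / 4)" for k
  have "\<exists>p>0. (\<forall>q. y \<le> q \<longrightarrow> q \<le> 1 \<longrightarrow> q + p * (q - q\<^sup>2) \<le> (2 * q - y) / (c k * y)) \<and>
      2 * (1 - c k * y\<^sup>2) * \<rho> k + c k * y\<^sup>2 * (min (17/16) ((5 - y) / 4) * (1 + 1 / p)) \<le> 2"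
    if "1 \<le> k" for k
    using y0 y1 c[OF that] unfolding \<rho>_def by (rule step_parameter) auto
  then obtain p where p: "\<And>k. 1 \<le> k \<Longrightarrow> 0 < p k"
    "\<And>k q. 1 \<le> k \<Longrightarrow> y \<le> q \<Longrightarrow> q \<le> 1 \<Longrightarrow> q + p k * (q - q\<^sup>2) \<le> (2 * q - y) / (c k * y)"
    "\<And>k. 1 \<le> k \<Longrightarrow>
      2 * (1 - lmin * \<alpha> k) * \<rho> k + lmin * \<alpha> k * (min (17/16) ((5 - y) / 4) * (1 + 1 / p k)) \<le> 2"
    unfolding cy by metis
  define \<kappa> where "\<kappa> k = min (17/16) ((5 - y) / 4) * (1 + 1 / p k)" for k
  define avg where "avg k z = agent_avg (td_iterate W \<alpha> \<gamma> \<phi> r \<theta>0 z k)" for k z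
  define past where "past k \<omega> = restrict (\<lambda>i. \<zeta> i \<omega>) {1..k}" for k \<omega>
  have \<theta>bar_past: "\<theta>bar k \<omega> = avg k (past k \<omega>)" for k \<omega>
    unfolding \<theta>bar_def avg_def past_def by (subst td_iterate_cong) auto
  have \<theta>bar_Suc: "\<theta>bar (Suc k) \<omega> = \<theta>bar k \<omega> + \<alpha> (Suc k) *\<^sub>R
      (td_bbar \<phi> r (\<zeta> (Suc k) \<omega>) - td_A \<gamma> \<phi> (\<zeta> (Suc k) \<omega>) *v \<theta>bar k \<omega>)" for k \<omega>
    unfolding \<theta>bar_def using mixing
    by (intro agent_avg_td_iterate_Suc) (simp add: doubly_stochastic_mixing_def)
  have step: "err (Suc k) \<le> (1 - lmin * \<alpha> (Suc k)) * err k + (\<alpha> (Suc k))\<^sup>2 * (\<kappa> (Suc k) * C)" for k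
  proof -
    \<comment> \<open>The squared error after a step from the past \<open>x\<close> with sample
      \<open>z\<close>. The sum \<open>avg k x - \<theta>star + \<theta>star\<close> is kept to
      match \<open>mean_square_step\<close> with \<open>e = avg k x - \<theta>star\<close>.\<close>
    define h where "h x z = (norm (avg k x - \<theta>star + \<alpha> (Suc k) *\<^sub>R
      (td_bbar \<phi> r z - td_A \<gamma> \<phi> z *v (avg k x - \<theta>star + \<theta>star))))\<^sup>2" for x z
    have h: "measure_pmf.expectation ?p (h x) \<le>
        (1 - lmin * \<alpha> (Suc k)) * (norm (avg k x - \<theta>star))\<^sup>2 + (\<alpha> (Suc k))\<^sup>2 * (\<kappa> (Suc k) * C)" for x
      unfolding h_def \<kappa>_def C_def
    proof (rule mean_square_step[where p = ?p and G = "td_A \<gamma> \<phi>" and b = "td_bbar \<phi> r"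
          and lam = lmin and \<beta> = \<beta> and \<alpha> = "\<alpha> (Suc k)" and k = "p (Suc k)",
          folded A_def bbar_def y_def c_def])
      show "0 < \<alpha> (Suc k)" "0 < p (Suc k)" by (simp_all add: step_pos p)
      show "q + p (Suc k) * (q - q\<^sup>2) \<le> (2 * q - y) / (c (Suc k) * y)" if "y \<le> q" "q \<le> 1" for q
        using that by (intro p(2)) simp_all
    qed (rule lmin \<beta> growth coercive \<theta>star noise_bound)+
    have int: "integrable M (\<lambda>\<omega>. f (past k \<omega>))" for f :: "_ \<Rightarrow> real"
      unfolding past_def by (rule integrable_past[OF indep ident]) simp
    have "err (Suc k) = expectation (\<lambda>\<omega>. h (past k \<omega>) (\<zeta> (Suc k) \<omega>))"
      unfolding err_def h_def \<theta>bar_Suc by (simp add: \<theta>bar_past algebra_simps)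
    also have "\<dots> = expectation (\<lambda>\<omega>. measure_pmf.expectation ?p (h (past k \<omega>)))"
      unfolding past_def by (rule expectation_past_next[OF indep ident]) simp
    also have "\<dots> \<le> expectation (\<lambda>\<omega>. (1 - lmin * \<alpha> (Suc k)) * (norm (avg k (past k \<omega>) - \<theta>star))\<^sup>2
        + (\<alpha> (Suc k))\<^sup>2 * (\<kappa> (Suc k) * C))"
      by (intro integral_mono h int)
    also have "\<dots> = (1 - lmin * \<alpha> (Suc k)) * err k + (\<alpha> (Suc k))\<^sup>2 * (\<kappa> (Suc k) * C)"
      by (subst Bochner_Integration.integral_add)
        (simp_all add: int[of "\<lambda>x. (norm (avg k x - \<theta>star))\<^sup>2"] err_def \<theta>bar_past prob_space)
    finally show ?thesis .
  qed
  have "err (t + 1) \<le> (\<Prod>i=1..t+1. 1 - lmin * \<alpha> i) * err 0 + (2 / lmin) * C * \<alpha> (t + 1)"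
  proof (rule recursion_bound[where \<kappa> = \<kappa> and \<rho> = \<rho>, OF lmin C])
    fix k :: nat assume k: "1 \<le> k"
    show "0 < \<alpha> k" using step_pos[OF k] .
    show "lmin * \<alpha> k \<le> 1"
      using c[OF k] y0 y1 unfolding cy[symmetric] by (simp add: mult_le_one power_le_one)
    show "0 \<le> \<rho> k" using c[OF k] by (simp add: \<rho>_def)
    show "2 * (1 - lmin * \<alpha> k) * \<rho> k + lmin * \<alpha> k * \<kappa> k \<le> 2"
      unfolding \<kappa>_def by (rule p(3)[OF k])
    define x where "x = lmin * \<alpha> (Suc k)"
    have x: "0 < \<alpha> (Suc k)" "0 < x" using step_pos lmin by (simp_all add: x_def)
    \<comment> \<open>The tangent of the square root at 1 turns \<open>step_ratio\<close> into the
      affine bound in \<open>\<rho>\<close>.\<close>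
    have "(sqrt (1 + x / 2))\<^sup>2 \<le> (1 + x / 4)\<^sup>2" using x by (simp add: power2_eq_square field_simps)
    then have "sqrt (1 + x / 2) \<le> 1 + x / 4" by (rule power2_le_imp_le) (use x in simp)
    then have "\<alpha> k / \<alpha> (Suc k) \<le> 1 + x / 4" using step_ratio[OF k] by (simp add: x_def)
    then have "\<alpha> k \<le> (1 + c (Suc k) * y\<^sup>2 / 4) * \<alpha> (Suc k)"
      using x unfolding cy x_def by (simp add: field_simps)
    moreover have "\<alpha> k \<le> 1 / c (Suc k) * \<alpha> (Suc k)"
      using step_bound[OF k] x lmin \<beta> by (simp add: c_def)
    ultimately show "\<alpha> k \<le> \<rho> (Suc k) * \<alpha> (Suc k)"
      by (simp add: \<rho>_def min_def)
  qed (simp_all add: step)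
  moreover have "err 0 = (norm (agent_avg \<theta>0 - \<theta>star))\<^sup>2"
    by (simp add: err_def \<theta>bar_def prob_space)
  ultimately show ?thesis by (simp add: err_def C_def)
qed

end
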